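(* Let $X=Y^\star$, $P$, $j$, $A$, $S$ and the families $\{q_t\}_{0<t<t_0}$, $\{\bar x_t\}_{0\le t<t_0}$, the direction $q$, the operators $A_p,A_x$ and the difference quotients $y_t=(\bar x_t-\bar x_0)/t$ be as in the context, and set $a_0:=-A(0,\bar x_0)$. Suppose that there exists $y\in X$ such that $y_t\stackrel{\star}{\rightharpoonup}y$ in $X$ and $A_xy_t\to A_xy$ in $Y$ for $t\searrow0$. Then $y$ satisfies $$\langle A_pq+A_xy,z-y\rangle+\tfrac12Q_j^{\bar x_0,a_0}(z)-\tfrac12Q_j^{\bar x_0,a_0}(y)\ge0\qquad\forall z\in X,$$ and it holds $$Q_j^{\bar x_0,a_0}(y)=-\langle A_pq+A_xy,y\rangle<+\infty$$ as well as $$Q_j^{\bar x_0,a_0}(y)=\lim_{t\searrow0}\frac{j(\bar x_0+t\,y_t)-j(\bar x_0)-t\langle a_0,y_t\rangle}{t^2/2}.$$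
   Context: Setting: $Y$ is a (real) Banach space that is reflexive or separable, $X=Y^\star$ is its topological dual, $\langle\cdot,\cdot\rangle$ is the dual pairing between $Y$ and $X$, $P$ is a normed vector space, $j:X\to(-\infty,\infty]$ is proper ($j\not\equiv\infty$, not necessarily convex), $\operatorname{dom}(j)=\{x\in X: j(x)\in\mathbb R\}$, and $A:P\times X\to Y$ is a mapping. For $p\in P$, $S(p)$ is the (possibly empty or non-singleton) set of all $\bar x\in\operatorname{dom}(j)$ with $\langle A(p,\bar x),x-\bar x\rangle+j(x)-j(\bar x)\ge0$ for all $x\in X$. Standing assumptions on the families: for some $t_0>0$ there are given $\{q_t\}_{0<t<t_0}\subset P$ and $\{\bar x_t\}_{0\le t<t_0}\subset X$ such that (i) $q_t\to q$ in $P$ for $t\searrow0$ with some $q\in P$; (ii) $\bar x_t\in S(tq_t)$ for all $0<t<t_0$, $\bar x_0\in S(0)$, and there is $L>0$ with $\|\bar x_t-\bar x_0\|_X\le Lt$ for all $t\in[0,t_0)$; (iii) there are bounded linear operators $A_p\in\mathcal L(P,Y)$, $A_x\in\mathcal L(X,Y)$ such that $y_t:=(\bar x_t-\bar x_0)/t$ satisfies $A(tq_t,\bar x_0+ty_t)=A(0,\bar x_0)+tA_pq_t+tA_xy_t+r(t)$ for $0<t<t_0$, with $r:(0,t_0)\to Y$ satisfying $\|r(t)\|_Y/t\to0$ as $t\searrow0$. Weak-$\star$ second subderivative: for $x\in\operatorname{dom}(j)$, $g\in Y$, the functional $Q_j^{x,g}:X\to[-\infty,\infty]$ is $$Q_j^{x,g}(z):=\inf\Big\{\liminf_{n\to\infty}\frac{j(x+t_nz_n)-j(x)-t_n\langle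 g,z_n\rangle}{t_n^2/2}\ \Big|\ t_n\searrow0,\ z_n\stackrel{\star}{\rightharpoonup}z\Big\},$$ the infimum being over all sequences $\{t_n\}\subset(0,\infty)$, $\{z_n\}\subset X$ as indicated. *)

theory Defs
  imports "HOL-Analysis.Analysis"
begin

type_synonym 'y dual = "'y \<Rightarrow>\<^sub>L real"

abbreviation pairing :: "'y::real_normed_vector \<Rightarrow> 'y dual \<Rightarrow> real"
  where "pairing g x \<equiv> blinfun_apply x g"

definition canonical_embedding :: "'y::real_normed_vector \<Rightarrow> 'y dual dual"
  where "canonical_embedding g = Blinfun (\<lambda>x. pairing g x)"

lemma canonical_embedding_apply [simp]: "blinfun_apply (canonical_embedding g) x = pairing g x"
  unfolding canonical_embedding_def
  by (simp add: bounded_linear_Blinfun_apply blinfun.bounded_linear_left)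

definition reflexive_space :: "'y::real_normed_vector itself \<Rightarrow> bool"
  where "reflexive_space TYPE('y) \<longleftrightarrow> surj (canonical_embedding :: 'y \<Rightarrow> 'y dual dual)"

text \<open>For functionals, the strong operator topology (pointwise convergence on \<open>Y\<close>) is the
  weak-star topology.\<close>

abbreviation weak_star_topology :: "'y::real_normed_vector dual topology"
  where "weak_star_topology \<equiv> strong_operator_topology"

lemma limitin_weak_star_iff:
  "limitin weak_star_topology f l F \<longleftrightarrow> (\<forall>g. ((\<lambda>i. pairing g (f i)) \<longlongrightarrow> pairing g l) F)"
proof
  assume "limitin weak_star_topology f l F"
  then have "limitin euclidean ((\<lambda>x. pairing g x) \<circ> f) (pairing g l) F" for g
    by (rule continuous_map_limit[OF strong_operator_topology_continuous_evaluation])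
  then show "\<forall>g. ((\<lambda>i. pairing g (f i)) \<longlongrightarrow> pairing g l) F"
    by (simp add: o_def)
next
  assume *: "\<forall>g. ((\<lambda>i. pairing g (f i)) \<longlongrightarrow> pairing g l) F"
  have "limitin (product_topology (\<lambda>_. euclidean) UNIV)
          (\<lambda>i. blinfun_apply (f i)) (blinfun_apply l) F"
    using * by (simp add: limitin_componentwise)
  then have lim: "limitin euclidean (\<lambda>i. blinfun_apply (f i)) (blinfun_apply l) F"
    by (simp add: euclidean_product_topology)
  show "limitin weak_star_topology f l F"
    unfolding limitin_def
  proof (intro conjI allI impI)
    show "l \<in> topspace weak_star_topology"
      by (simp add: strong_operator_topology_topspace)
  next
    fix U assume U: "openin weak_star_topology U \<and> l \<in> U"
    then obtain V where "open V" "U = blinfun_apply -` V"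
      unfolding strong_operator_topology_def openin_pullback_topology by auto
    with U lim show "eventually (\<lambda>i. f i \<in> U) F"
      by (auto simp: limitin_def)
  qed
qed

definition proper :: "('x \<Rightarrow> ereal) \<Rightarrow> bool"
  where "proper j \<longleftrightarrow> (\<forall>x. j x \<noteq> -\<infinity>) \<and> (\<exists>x. j x \<noteq> \<infinity>)"

definition effective_domain :: "('x \<Rightarrow> ereal) \<Rightarrow> 'x set"
  where "effective_domain j = {x. \<bar>j x\<bar> \<noteq> \<infinity>}"

definition solution_set ::
  "('p \<Rightarrow> 'y::real_normed_vector dual \<Rightarrow> 'y) \<Rightarrow> ('y dual \<Rightarrow> ereal) \<Rightarrow> 'p \<Rightarrow> 'y dual set"
  where "solution_set A j p =
    {xb \<in> effective_domain j. \<forall>x. ereal (pairing (A p xb) (x - xb)) + j x - j xb \<ge> 0}"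

definition difference_quotient :: "(real \<Rightarrow> 'x::real_vector) \<Rightarrow> real \<Rightarrow> 'x"
  where "difference_quotient x t = (x t - x 0) /\<^sub>R t"

definition second_order_quotient ::
  "('y::real_normed_vector dual \<Rightarrow> ereal) \<Rightarrow> 'y dual \<Rightarrow> 'y \<Rightarrow> real \<Rightarrow> 'y dual \<Rightarrow> ereal"
  where "second_order_quotient j x g t z =
    (j (x + t *\<^sub>R z) - j x - ereal (t * pairing g z)) / ereal (t\<^sup>2 / 2)"

text \<open>As usual, \<open>t\<^sub>n \<searrow> 0\<close> means that \<open>t\<^sub>n > 0\<close> and \<open>t\<^sub>n \<rightarrow> 0\<close>; monotonicity is not required.
  Requiring it would not change the infimum (pass to subsequences).\<close>

definition second_subderivative ::
  "('y::real_normed_vector dual \<Rightarrow> ereal) \<Rightarrow> 'y dual \<Rightarrow> 'y \<Rightarrow> 'y dual \<Rightarrow> ereal"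
  where "second_subderivative j x g z =
    Inf {liminf (\<lambda>n. second_order_quotient j x g (t n) (zs n)) | t zs.
           (\<forall>n. t n > 0) \<and> t \<longlonglongrightarrow> 0 \<and> limitin weak_star_topology zs z sequentially}"

end

theory Submission
  imports Defs
begin

text \<open>Let \<open>D\<^sub>t\<close> be the second-order difference quotient of \<open>j\<close> and
  \<open>h\<^sub>t = A\<^sub>p q\<^sub>t + A\<^sub>x y\<^sub>t + r(t) / t\<close>, which converges in norm to
  \<open>g = A\<^sub>p q + A\<^sub>x y\<close>. The variational inequality for \<open>x\<^sub>t\<close> reads
  \<open>D\<^sub>t(y\<^sub>t) \<le> D\<^sub>t(z) + 2 \<langle>h\<^sub>t, z - y\<^sub>t\<rangle>\<close> for all \<open>z\<close>.
  With \<open>z = k y\<^bsub>kt\<^esub>\<close> it becomes a scaling inequality for \<open>d(t) = D\<^sub>t(y\<^sub>t)\<close>, namely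
  \<open>d(t) \<le> k\<^sup>2 d(kt) + 2 (k - 1) \<langle>g, y\<rangle> + o(1)\<close> for every \<open>k > 0\<close>.
  Iterating it along geometric sequences (for \<open>k < 1\<close> from above, for \<open>k > 1\<close> from below)
  and then letting \<open>k \<rightarrow> 1\<close> gives \<open>d(t) \<rightarrow> - \<langle>g, y\<rangle>\<close> without any convexity of \<open>j\<close>.
  Passing to the limit in the variational inequality along a sequence \<open>z\<^sub>n\<close> converging weak-star to
  \<open>z\<close>, bounded by Banach-Steinhaus, yields \<open>Q(z) \<ge> - \<langle>g, y\<rangle> - 2 \<langle>g, z - y\<rangle>\<close>.\<close>

section \<open>Banach-Steinhaus and weak-star convergence\<close>

text \<open>Baire category: the closed sets \<open>C k\<close> of points where all
  \<open>f i\<close> are bounded by \<open>k\<close> cover the space, so one of them contains a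
  ball; by linearity a bound on a ball bounds all operator norms.\<close>

lemma uniform_boundedness:
  fixes f :: "'i \<Rightarrow> 'a::banach \<Rightarrow>\<^sub>L 'b::real_normed_vector"
  assumes "\<And>x. bounded (range (\<lambda>i. f i x))"
  shows "bounded (range f)"
proof -
  define C where "C k = {x. \<forall>i. norm (f i x) \<le> real k}" for k
  have closed: "closed (C k)" for k
    unfolding C_def by (intro closed_Collect_all closed_Collect_le continuous_intros)
  have "\<exists>k. x \<in> C k" for x
  proof -
    obtain b where "\<forall>i. norm (f i x) \<le> b"
      using assms[of x] by (auto simp: bounded_iff)
    moreover obtain k where "b \<le> real k"
      using real_arch_simple by blast
    ultimately show ?thesis
      unfolding C_def using order_trans by blast
  qed
  then have cover: "\<Union>(range C) = UNIV"
    by blast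
  have "\<exists>k. interior (C k) \<noteq> {}"
  proof (rule ccontr)
    assume "\<nexists>k. interior (C k) \<noteq> {}"
    then have "(euclidean :: 'a topology) interior_of \<Union>(range C) = {}"
      by (intro Baire_category_alt)
        (auto simp: completely_metrizable_space_euclidean closed)
    then show False
      by (simp add: cover)
  qed
  then obtain k a where "a \<in> interior (C k)"
    by blast
  then obtain e where e: "e > 0" "cball a e \<subseteq> C k"
    by (auto simp: mem_interior_cball)
  have "norm (f i) \<le> 2 * real k / e" for i
  proof (rule norm_blinfun_bound)
    show "0 \<le> 2 * real k / e"
      using e by simp
    fix x
    show "norm (f i x) \<le> 2 * real k / e * norm x"
    proof (cases "x = 0")
      case False
      \<comment> \<open>\<open>v\<close> is \<open>x\<close> rescaled to the radius of the ball, so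
        \<open>f i v\<close> is a difference of two values of norm at most \<open>k\<close>; hence
        the constant \<open>2 * real k / e\<close>.\<close>
      define v where "v = (e / norm x) *\<^sub>R x"
      have "norm v = e"
        using False e by (simp add: v_def)
      then have "a + v \<in> cball a e" "a \<in> cball a e"
        using e by (auto simp: dist_norm)
      then have "a + v \<in> C k" "a \<in> C k"
        using e by blast+
      then have "norm (f i (a + v)) \<le> real k" "norm (f i a) \<le> real k"
        by (auto simp: C_def)
      then have "norm (f i (a + v) - f i a) \<le> 2 * real k"
        using norm_triangle_ineq4[of "f i (a + v)" "f i a"] by linarith
      then have "e / norm x * norm (f i x) \<le> 2 * real k"
        using e by (simp add: v_def blinfun.add_right blinfun.scaleR_right)
      then show ?thesis
        using False e by (simp add: field_simps)
    qed simp
  qed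
  then show ?thesis
    by (auto simp: bounded_iff)
qed

lemma weak_star_convergent_imp_bounded:
  fixes x :: "nat \<Rightarrow> 'y::banach dual"
  assumes "limitin weak_star_topology x l sequentially"
  shows "bounded (range x)"
proof (rule uniform_boundedness)
  fix g
  have "(\<lambda>n. pairing g (x n)) \<longlonglongrightarrow> pairing g l"
    using assms by (simp add: limitin_weak_star_iff)
  then show "bounded (range (\<lambda>n. pairing g (x n)))"
    by (rule convergent_imp_bounded)
qed

text \<open>Strong times weak-star convergence: the error \<open>g i - g0\<close> is absorbed by the
  bound on \<open>x i\<close>, and \<open>g0\<close> is a fixed test vector. The bound is assumed
  because weak-star convergence along a general filter does not imply it.\<close>

lemma tendsto_pairing_weak_star:
  fixes x :: "'i \<Rightarrow> 'y::real_normed_vector dual"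
  assumes g: "(g \<longlongrightarrow> g0) F"
    and x: "limitin weak_star_topology x l F"
    and B: "eventually (\<lambda>i. norm (x i) \<le> B) F"
  shows "((\<lambda>i. pairing (g i) (x i)) \<longlongrightarrow> pairing g0 l) F"
proof -
  have "((\<lambda>i. B * norm (g i - g0)) \<longlongrightarrow> B * norm (g0 - g0)) F"
    by (intro tendsto_intros g)
  then have "((\<lambda>i. B * norm (g i - g0)) \<longlongrightarrow> 0) F"
    by simp
  moreover have "eventually (\<lambda>i. norm (pairing (g i - g0) (x i)) \<le> B * norm (g i - g0)) F"
    using B
  proof eventually_elim
    case (elim i)
    have "norm (pairing (g i - g0) (x i)) \<le> norm (x i) * norm (g i - g0)"
      by (rule norm_blinfun)
    also have "\<dots> \<le> B * norm (g i - g0)"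
      using elim by (intro mult_right_mono) auto
    finally show ?case .
  qed
  ultimately have "((\<lambda>i. pairing (g i - g0) (x i)) \<longlongrightarrow> 0) F"
    by (rule Lim_null_comparison[rotated])
  moreover have "((\<lambda>i. pairing g0 (x i)) \<longlongrightarrow> pairing g0 l) F"
    using x by (simp add: limitin_weak_star_iff)
  ultimately have "((\<lambda>i. pairing (g i - g0) (x i) + pairing g0 (x i)) \<longlongrightarrow> 0 + pairing g0 l) F"
    by (rule tendsto_add)
  then show ?thesis
    by (simp add: blinfun.diff_right)
qed

section \<open>Scaling inequalities for real functions near zero\<close>

lemma filterlim_mult_at_right_0:
  fixes k :: real
  assumes "k > 0"
  shows "filterlim (\<lambda>t. k * t) (at_right 0) (at_right 0)"
  using assms filterlim_times_pos[of "\<lambda>t. t" 0 "at_right 0" k] filterlim_ident by auto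

text \<open>Once \<open>u \<le> u0 + \<epsilon>\<close>, the excess of \<open>d\<close> over the fixed point \<open>(u0 + \<epsilon>) / (1 - k\<^sup>2)\<close>
  shrinks by \<open>k\<^sup>2\<close> along \<open>k ^ n * s\<close>; as \<open>d\<close> is bounded, it cannot be positive.\<close>

lemma eventually_le_of_scaling_inequality:
  fixes d u :: "real \<Rightarrow> real"
  assumes k: "0 < k" "k < 1"
    and bound: "eventually (\<lambda>s. d s \<le> B) (at_right 0)"
    and scale: "eventually (\<lambda>s. d s \<le> k\<^sup>2 * d (k * s) + u s) (at_right 0)"
    and u: "(u \<longlongrightarrow> u0) (at_right 0)"
    and a: "u0 / (1 - k\<^sup>2) < a"
  shows "eventually (\<lambda>s. d s \<le> a) (at_right 0)"
proof -
  have k2: "0 < k\<^sup>2" "k\<^sup>2 < 1"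
    using k by (simp_all add: power_less_one_iff)
  then have "u0 < a * (1 - k\<^sup>2)"
    using a by (simp add: divide_less_eq)
  then have "eventually (\<lambda>s. u s < a * (1 - k\<^sup>2)) (at_right 0)"
    by (rule order_tendstoD[OF u])
  \<comment> \<open>Since \<open>u s < a * (1 - k\<^sup>2)\<close>, the number \<open>a\<close>
    serves as the fixed point and the excess \<open>d s - a\<close> contracts.\<close>
  with bound scale
  have "eventually (\<lambda>s. d s \<le> B \<and> d s - a \<le> k\<^sup>2 * (d (k * s) - a)) (at_right 0)"
    by eventually_elim (simp add: algebra_simps)
  then obtain \<delta> where \<delta>: "\<delta> > 0"
    and d: "\<And>s. 0 < s \<Longrightarrow> s < \<delta> \<Longrightarrow> d s \<le> B \<and> d s - a \<le> k\<^sup>2 * (d (k * s) - a)"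
    unfolding eventually_at_right_field by auto
  have "d s \<le> a" if s: "0 < s" "s < \<delta>" for s
  proof -
    have ks: "0 < k ^ n * s \<and> k ^ n * s < \<delta>" for n
    proof
      show "0 < k ^ n * s"
        using k s by simp
      have "k ^ n * s \<le> 1 * s"
        using k s by (intro mult_right_mono power_le_one) auto
      with s show "k ^ n * s < \<delta>"
        by linarith
    qed
    have iter: "d s - a \<le> (k\<^sup>2) ^ n * (d (k ^ n * s) - a)" for n
    proof (induction n)
      case (Suc n)
      have "(k\<^sup>2) ^ n * (d (k ^ n * s) - a) \<le> (k\<^sup>2) ^ n * (k\<^sup>2 * (d (k * (k ^ n * s)) - a))"
        using ks d k2 by (intro mult_left_mono) auto
      with Suc show ?case
        by (simp add: mult_ac)
    qed simp
    have "d s - a \<le> (k\<^sup>2) ^ n * (B - a)" for n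
    proof -
      have "(k\<^sup>2) ^ n * (d (k ^ n * s) - a) \<le> (k\<^sup>2) ^ n * (B - a)"
        using ks d k2 by (intro mult_left_mono) auto
      with iter[of n] show ?thesis
        by simp
    qed
    moreover have "(\<lambda>n. (k\<^sup>2) ^ n * (B - a)) \<longlonglongrightarrow> 0 * (B - a)"
      using k2 by (intro tendsto_intros LIMSEQ_power_zero) auto
    ultimately have "d s - a \<le> 0 * (B - a)"
      by (intro LIMSEQ_le_const) auto
    then show ?thesis
      by simp
  qed
  with \<delta> show ?thesis
    unfolding eventually_at_right_field by auto
qed

text \<open>For \<open>0 < k < 1\<close> the recursion with limiting inhomogeneity
  \<open>2 * (k - 1) * c\<close> has the fixed point \<open>- 2 * c / (1 + k)\<close>, which tends
  to \<open>- c\<close> as \<open>k\<close> tends to 1. This bounds \<open>d\<close> from above; the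
  factor \<open>1 / k\<close>, rewritten as a recursion for \<open>- d\<close>, bounds it from
  below.\<close>

lemma tendsto_of_scaling_inequalities:
  fixes d :: "real \<Rightarrow> real" and u :: "real \<Rightarrow> real \<Rightarrow> real"
  assumes bound: "eventually (\<lambda>s. \<bar>d s\<bar> \<le> B) (at_right 0)"
    and scale: "\<And>k. k > 0 \<Longrightarrow> eventually (\<lambda>s. d s \<le> k\<^sup>2 * d (k * s) + u k s) (at_right 0)"
    and u: "\<And>k. k > 0 \<Longrightarrow> (u k \<longlongrightarrow> 2 * (k - 1) * c) (at_right 0)"
  shows "(d \<longlongrightarrow> - c) (at_right 0)"
proof (rule order_tendstoI)
  fix a assume "- c < a"
  have "((\<lambda>k. - 2 * c / (1 + k)) \<longlongrightarrow> - 2 * c / (1 + 1)) (at_left 1)"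
    by (intro tendsto_intros) auto
  moreover obtain b where b: "- c < b" "b < a"
    using \<open>- c < a\<close> dense by blast
  ultimately have "eventually (\<lambda>k. - 2 * c / (1 + k) < b) (at_left 1)"
    by (intro order_tendstoD) auto
  moreover have "eventually (\<lambda>k::real. k \<in> {0<..<1}) (at_left 1)"
    by (rule eventually_at_left_real) simp
  ultimately have "eventually (\<lambda>k. - 2 * c / (1 + k) < b \<and> k \<in> {0<..<1}) (at_left 1)"
    by (rule eventually_conj)
  then obtain k where k: "0 < k" "k < 1" "- 2 * c / (1 + k) < b"
    using eventually_happens' trivial_limit_at_left_real
    by (metis (no_types, lifting) greaterThanLessThan_iff)
  have "2 * (k - 1) * c / (1 - k\<^sup>2) = - 2 * c / (1 + k)"
  proof -
    have "1 - k\<^sup>2 = (1 - k) * (1 + k)"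
      by (simp add: power2_eq_square algebra_simps)
    moreover have "2 * (k - 1) * c = - 2 * c * (1 - k)"
      by (simp add: algebra_simps)
    ultimately show ?thesis
      using k by simp
  qed
  then have "2 * (k - 1) * c / (1 - k\<^sup>2) < b"
    using k by simp
  moreover have "eventually (\<lambda>s. d s \<le> B) (at_right 0)"
    using bound by (auto elim: eventually_mono)
  ultimately have "eventually (\<lambda>s. d s \<le> b) (at_right 0)"
    using eventually_le_of_scaling_inequality[OF k(1,2) _ scale[OF k(1)] u[OF k(1)]] by blast
  then show "eventually (\<lambda>s. d s < a) (at_right 0)"
    using b by (auto elim: eventually_mono)
next
  fix a assume "a < - c"
  have "((\<lambda>k. 2 * k * c / (1 + k)) \<longlongrightarrow> 2 * 1 * c / (1 + 1)) (at_left 1)"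
    by (intro tendsto_intros) auto
  moreover obtain b where b: "a < b" "b < - c"
    using \<open>a < - c\<close> dense by blast
  ultimately have "eventually (\<lambda>k. 2 * k * c / (1 + k) < - b) (at_left 1)"
    by (intro order_tendstoD) auto
  moreover have "eventually (\<lambda>k::real. k \<in> {0<..<1}) (at_left 1)"
    by (rule eventually_at_left_real) simp
  ultimately have "eventually (\<lambda>k. 2 * k * c / (1 + k) < - b \<and> k \<in> {0<..<1}) (at_left 1)"
    by (rule eventually_conj)
  then obtain k where k: "0 < k" "k < 1" "2 * k * c / (1 + k) < - b"
    using eventually_happens' trivial_limit_at_left_real
    by (metis (no_types, lifting) greaterThanLessThan_iff)
  \<comment> \<open>The inequality for the factor \<open>1 / k\<close> at the point
    \<open>k * s\<close>, multiplied by \<open>k\<^sup>2\<close> and solved for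
    \<open>- d s\<close>, has the inhomogeneity \<open>v\<close>. The resulting fixed point is
    \<open>2 * k * c / (1 + k)\<close>.\<close>
  define v where "v s = k\<^sup>2 * u (1 / k) (k * s)" for s
  have lim: "filterlim (\<lambda>s. k * s) (at_right 0) (at_right 0)"
    using k by (intro filterlim_mult_at_right_0)
  have "(v \<longlongrightarrow> k\<^sup>2 * (2 * (1 / k - 1) * c)) (at_right 0)"
    unfolding v_def using k
    by (intro tendsto_intros filterlim_compose[OF u lim]) auto
  moreover have "k\<^sup>2 * (2 * (1 / k - 1) * c) / (1 - k\<^sup>2) < - b"
  proof -
    have "1 - k\<^sup>2 = (1 - k) * (1 + k)"
      by (simp add: power2_eq_square algebra_simps)
    moreover have "k\<^sup>2 * (2 * (1 / k - 1) * c) = 2 * k * c * (1 - k)"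
      using k by (simp add: field_simps power2_eq_square)
    ultimately have "k\<^sup>2 * (2 * (1 / k - 1) * c) / (1 - k\<^sup>2) = 2 * k * c / (1 + k)"
      using k by (simp only:) simp
    with k show ?thesis
      by simp
  qed
  moreover have "eventually (\<lambda>s. - d s \<le> k\<^sup>2 * - d (k * s) + v s) (at_right 0)"
  proof -
    have "eventually (\<lambda>s. d (k * s) \<le> (1 / k)\<^sup>2 * d (1 / k * (k * s)) + u (1 / k) (k * s))
        (at_right 0)"
      using k by (intro eventually_compose_filterlim[OF scale lim]) auto
    then show ?thesis
    proof eventually_elim
      case (elim s)
      have "k\<^sup>2 * d (k * s) \<le> k\<^sup>2 * ((1 / k)\<^sup>2 * d (1 / k * (k * s)) + u (1 / k) (k * s))"
        using elim by (rule mult_left_mono) simp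
      also have "\<dots> = d s + v s"
        using k by (simp add: v_def field_simps)
      finally show ?case
        by simp
    qed
  qed
  moreover have "eventually (\<lambda>s. - d s \<le> B) (at_right 0)"
    using bound by (auto elim: eventually_mono)
  ultimately have "eventually (\<lambda>s. - d s \<le> - b) (at_right 0)"
    using eventually_le_of_scaling_inequality[OF k(1,2), of "\<lambda>s. - d s" B v] by blast
  then show "eventually (\<lambda>s. a < d s) (at_right 0)"
    using b by (auto elim: eventually_mono)
qed

section \<open>Second-order difference quotients and the variational inequality\<close>

text \<open>Step \<open>t\<close> along \<open>k *\<^sub>R z\<close> and step \<open>k * t\<close>
  along \<open>z\<close> reach the same point, so only the denominators differ.\<close>

lemma second_order_quotient_scaleR:
  assumes "k > 0"
  shows "second_order_quotient j x g t (k *\<^sub>R z)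
    = ereal (k\<^sup>2) * second_order_quotient j x g (k * t) z"
proof (cases "t = 0")
  case True
  with assms show ?thesis
    by (simp add: second_order_quotient_def)
next
  case False
  have "j (x + t *\<^sub>R k *\<^sub>R z) - j x - ereal (t * pairing g (k *\<^sub>R z))
      = j (x + (k * t) *\<^sub>R z) - j x - ereal (k * t * pairing g z)"
    by (simp add: blinfun.scaleR_left mult_ac)
  moreover have "D / ereal (t\<^sup>2 / 2) = ereal (k\<^sup>2) * (D / ereal ((k * t)\<^sup>2 / 2))" for D
    using assms False by (cases D) (auto simp: field_simps power2_eq_square sgn_if)
  ultimately show ?thesis
    by (simp add: second_order_quotient_def)
qed

lemma second_order_quotient_zero:
  assumes "x \<in> effective_domain j"
  shows "second_order_quotient j x g t 0 = 0"
  using assms by (cases "j x") (auto simp: second_order_quotient_def effective_domain_def zero_ereal_def)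

lemma second_order_quotient_finite:
  assumes "x \<in> effective_domain j" "x + t *\<^sub>R z \<in> effective_domain j" "t \<noteq> 0"
  shows "\<bar>second_order_quotient j x g t z\<bar> \<noteq> \<infinity>"
  using assms by (cases "j x"; cases "j (x + t *\<^sub>R z)")
    (auto simp: second_order_quotient_def effective_domain_def)

text \<open>The variational inequality for \<open>x + t y\<close>, divided by \<open>t\<^sup>2 / 2\<close>.\<close>

lemma solution_set_second_order_quotient_le:
  assumes x: "x \<in> effective_domain j"
    and sol: "x + t *\<^sub>R y \<in> solution_set A j p"
    and A: "A p (x + t *\<^sub>R y) = t *\<^sub>R h - g"
    and t: "t > 0"
  shows "second_order_quotient j x g t y
    \<le> second_order_quotient j x g t z + ereal (2 * pairing h (z - y))"
proof -
  obtain a where a: "j x = ereal a"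
    using x by (cases "j x") (auto simp: effective_domain_def)
  obtain b where b: "j (x + t *\<^sub>R y) = ereal b"
    using sol by (cases "j (x + t *\<^sub>R y)") (auto simp: effective_domain_def solution_set_def)
  \<comment> \<open>The variational inequality is tested at
    \<open>x + t *\<^sub>R z\<close>.\<close>
  have "ereal (pairing (A p (x + t *\<^sub>R y)) (x + t *\<^sub>R z - (x + t *\<^sub>R y)))
      + j (x + t *\<^sub>R z) - j (x + t *\<^sub>R y) \<ge> 0"
    using sol unfolding solution_set_def by blast
  moreover have "x + t *\<^sub>R z - (x + t *\<^sub>R y) = t *\<^sub>R (z - y)"
    by (simp add: algebra_simps)
  ultimately have VI: "ereal (pairing (t *\<^sub>R h - g) (t *\<^sub>R (z - y)))
      + j (x + t *\<^sub>R z) - ereal b \<ge> 0"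
    by (simp add: A b)
  show ?thesis
  proof (cases "j (x + t *\<^sub>R z)")
    case (real c)
    have "0 \<le> t * (t * pairing h (z - y)) - t * pairing g (z - y) + c - b"
      using VI real by (simp add: blinfun.diff_right blinfun.scaleR_right blinfun.scaleR_left right_diff_distrib)
    then have "b - a - t * pairing g y
        \<le> c - a - t * pairing g z + t\<^sup>2 / 2 * (2 * pairing h (z - y))"
      by (simp add: blinfun.diff_left power2_eq_square algebra_simps)
    then have "(b - a - t * pairing g y) / (t\<^sup>2 / 2)
        \<le> (c - a - t * pairing g z + t\<^sup>2 / 2 * (2 * pairing h (z - y))) / (t\<^sup>2 / 2)"
      by (rule divide_right_mono) simp
    also have "\<dots> = (c - a - t * pairing g z) / (t\<^sup>2 / 2) + 2 * pairing h (z - y)"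
      using t by (subst add_divide_distrib) simp
    finally show ?thesis
      using t by (simp add: second_order_quotient_def a b real)
  next
    case PInf
    then show ?thesis
      using t by (simp add: second_order_quotient_def a)
  next
    \<comment> \<open>The value -\<infinity> would make the left side of \<open>VI\<close> equal to
      -\<infinity>.\<close>
    case MInf
    then show ?thesis
      using VI by simp
  qed
qed

section \<open>Limits of the quotients and the second subderivative\<close>

theorem theorem2p7:
  fixes j :: "'y::banach dual \<Rightarrow> ereal"
    and A :: "'p::real_normed_vector \<Rightarrow> 'y dual \<Rightarrow> 'y"
    and t0 L :: real
    and qt :: "real \<Rightarrow> 'p" and q :: 'p
    and xb :: "real \<Rightarrow> 'y dual"
    and Ap :: "'p \<Rightarrow>\<^sub>L 'y" and Ax :: "'y dual \<Rightarrow>\<^sub>L 'y"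
    and r :: "real \<Rightarrow> 'y"
    and a0 :: 'y and y :: "'y dual"
  assumes "reflexive_space TYPE('y) \<or> separable_space (euclidean :: 'y topology)"
    and "proper j"
    and "t0 > 0"
    and "(qt \<longlongrightarrow> q) (at_right 0)"
    and "\<forall>t\<in>{0<..<t0}. xb t \<in> solution_set A j (t *\<^sub>R qt t)"
    and "xb 0 \<in> solution_set A j 0"
    and "L > 0"
    and "\<forall>t\<in>{0..<t0}. norm (xb t - xb 0) \<le> L * t"
    and "\<forall>t\<in>{0<..<t0}.
           A (t *\<^sub>R qt t) (xb 0 + t *\<^sub>R difference_quotient xb t) =
           A 0 (xb 0) + t *\<^sub>R Ap (qt t) + t *\<^sub>R Ax (difference_quotient xb t) + r t"
    and "((\<lambda>t. norm (r t) / t) \<longlongrightarrow> 0) (at_right 0)"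
    and "a0 = - A 0 (xb 0)"
    and "limitin weak_star_topology (difference_quotient xb) y (at_right 0)"
    and "((\<lambda>t. Ax (difference_quotient xb t)) \<longlongrightarrow> Ax y) (at_right 0)"
  shows "(\<forall>z. ereal (pairing (Ap q + Ax y) (z - y))
              + ereal (1/2) * second_subderivative j (xb 0) a0 z
              - ereal (1/2) * second_subderivative j (xb 0) a0 y \<ge> 0)
       \<and> second_subderivative j (xb 0) a0 y = ereal (- pairing (Ap q + Ax y) y)
       \<and> second_subderivative j (xb 0) a0 y < \<infinity>
       \<and> ((\<lambda>t. second_order_quotient j (xb 0) a0 t (difference_quotient xb t))
            \<longlongrightarrow> second_subderivative j (xb 0) a0 y) (at_right 0)"
proof -
  define Y where "Y = difference_quotient xb"
  define Q where "Q = second_subderivative j (xb 0) a0"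
  define D where "D = second_order_quotient j (xb 0) a0"
  \<comment> \<open>\<open>h t\<close> is the increment of \<open>A\<close> along the family divided
    by \<open>t\<close>.\<close>
  define h where "h t = Ap (qt t) + Ax (Y t) + r t /\<^sub>R t" for t
  define G where "G = Ap q + Ax y"
  define d where "d t = real_of_ereal (D t (Y t))" for t
  have ev: "eventually (\<lambda>t. t \<in> {0<..<t0}) (at_right 0)"
    using assms(3) by (rule eventually_at_right_real)
  have dom: "xb 0 \<in> effective_domain j"
    using assms(6) by (simp add: solution_set_def)
  have xb: "xb 0 + t *\<^sub>R Y t = xb t" if "t \<in> {0<..<t0}" for t
    using that by (simp add: Y_def difference_quotient_def)
  have Y_le: "norm (Y t) \<le> L" if "t \<in> {0<..<t0}" for t
    using that assms(8) by (auto simp: Y_def difference_quotient_def divide_simps mult_ac)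
  have VI: "D t (Y t) \<le> D t z + ereal (2 * pairing (h t) (z - Y t))"
    if t: "t \<in> {0<..<t0}" for t z
    unfolding D_def
  proof (rule solution_set_second_order_quotient_le[OF dom])
    show "xb 0 + t *\<^sub>R Y t \<in> solution_set A j (t *\<^sub>R qt t)"
      using assms(5) t xb by simp
    show "A (t *\<^sub>R qt t) (xb 0 + t *\<^sub>R Y t) = t *\<^sub>R h t - a0"
      using assms(9,11) t by (simp add: Y_def h_def algebra_simps)
    show "0 < t"
      using t by simp
  qed
  have D_eq: "D t (Y t) = ereal (d t)" if t: "t \<in> {0<..<t0}" for t
  proof -
    have "\<bar>D t (Y t)\<bar> \<noteq> \<infinity>"
      unfolding D_def
      using assms(5) t xb[OF t] by (intro second_order_quotient_finite dom) (auto simp: solution_set_def)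
    then show ?thesis
      by (simp add: d_def ereal_real)
  qed
  \<comment> \<open>The unperturbed point \<open>xb 0\<close> solves the problem for parameter 0,
    which is the variational inequality with zero direction and \<open>h = 0\<close>.\<close>
  have D_nonneg: "0 \<le> D t z" if "t > 0" for t z
  proof -
    have "D t 0 \<le> D t z + ereal (2 * pairing 0 (z - 0))"
      unfolding D_def
      by (rule solution_set_second_order_quotient_le[OF dom _ _ that, where p=0 and A=A])
        (use assms(6,11) in auto)
    then show ?thesis
      by (simp add: D_def second_order_quotient_zero[OF dom])
  qed
  have "((\<lambda>t. norm (r t /\<^sub>R t)) \<longlongrightarrow> 0) (at_right 0)"
  proof (rule Lim_transform_eventually[OF assms(10)])
    show "eventually (\<lambda>t. norm (r t) / t = norm (r t /\<^sub>R t)) (at_right 0)"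
      using ev by eventually_elim (simp add: divide_inverse mult.commute)
  qed
  then have "((\<lambda>t. r t /\<^sub>R t) \<longlongrightarrow> 0) (at_right 0)"
    by (rule tendsto_norm_zero_cancel)
  from tendsto_add[OF tendsto_add[OF blinfun.tendsto[OF tendsto_const assms(4)] assms(13)] this]
  have h: "(h \<longlongrightarrow> G) (at_right 0)"
    by (simp add: h_def[abs_def] G_def Y_def)
  have Y: "limitin weak_star_topology Y y (at_right 0)"
    using assms(12) by (simp add: Y_def)
  \<comment> \<open>The scaled argument is needed for the test directions
    \<open>k *\<^sub>R Y (k * t)\<close>; \<open>Y (1 * t)\<close> below is the instance
    \<open>k = 1\<close>.\<close>
  have hY: "((\<lambda>t. pairing (h t) (Y (k * t))) \<longlongrightarrow> pairing G y) (at_right 0)"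
    if k: "k > 0" for k
  proof (rule tendsto_pairing_weak_star[OF h])
    have lim: "filterlim (\<lambda>t. k * t) (at_right 0) (at_right 0)"
      using k by (rule filterlim_mult_at_right_0)
    show "limitin weak_star_topology (\<lambda>t. Y (k * t)) y (at_right 0)"
      using Y unfolding limitin_weak_star_iff by (intro allI filterlim_compose[OF _ lim]) blast
    show "eventually (\<lambda>t. norm (Y (k * t)) \<le> L) (at_right 0)"
      using eventually_compose_filterlim[OF ev lim] by eventually_elim (rule Y_le)
  qed
  have d_lim: "(d \<longlongrightarrow> - pairing G y) (at_right 0)"
  proof (rule tendsto_of_scaling_inequalities)
    \<comment> \<open>Testing with \<open>z = 0\<close> gives
      \<open>d t \<le> - 2 * pairing (h t) (Y t)\<close>; the bound on \<open>d\<close> is the limit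
      of the right side plus a margin of 1.\<close>
    have "((\<lambda>t. - 2 * pairing (h t) (Y (1 * t))) \<longlongrightarrow> - 2 * pairing G y) (at_right 0)"
      by (intro tendsto_intros hY) simp
    then have "eventually (\<lambda>t. - 2 * pairing (h t) (Y (1 * t)) < - 2 * pairing G y + 1) (at_right 0)"
      by (rule order_tendstoD) simp
    with ev show "eventually (\<lambda>t. \<bar>d t\<bar> \<le> - 2 * pairing G y + 1) (at_right 0)"
    proof eventually_elim
      case (elim t)
      have "d t \<ge> 0"
        using D_nonneg[of t "Y t"] D_eq elim by simp
      moreover have "d t \<le> - 2 * pairing (h t) (Y t)"
        using VI[of t 0] elim D_eq
        by (simp add: D_def second_order_quotient_zero[OF dom] blinfun.minus_left)
      ultimately show ?case
        using elim by simp
    qed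
  next
    fix k :: real assume k: "k > 0"
    define u where "u t = 2 * (k * pairing (h t) (Y (k * t)) - pairing (h t) (Y (1 * t)))" for t
    have "(u \<longlongrightarrow> 2 * (k * pairing G y - pairing G y)) (at_right 0)"
      unfolding u_def using k by (intro tendsto_intros hY) auto
    then show "((\<lambda>t. 2 * (k * pairing (h t) (Y (k * t)) - pairing (h t) (Y (1 * t))))
        \<longlongrightarrow> 2 * (k - 1) * pairing G y) (at_right 0)"
      by (simp add: u_def[abs_def] algebra_simps)
    have "eventually (\<lambda>t. k * t \<in> {0<..<t0}) (at_right 0)"
      by (rule eventually_compose_filterlim[OF ev filterlim_mult_at_right_0[OF k]])
    with ev show "eventually (\<lambda>t. d t \<le> k\<^sup>2 * d (k * t)
        + 2 * (k * pairing (h t) (Y (k * t)) - pairing (h t) (Y (1 * t)))) (at_right 0)"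
    proof eventually_elim
      case (elim t)
      \<comment> \<open>By scaling, the quotient in this test direction is again a value of
        \<open>d\<close>, now at \<open>k * t\<close>.\<close>
      have "D t (k *\<^sub>R Y (k * t)) = ereal (k\<^sup>2 * d (k * t))"
        using D_eq[OF elim(2)] by (simp add: D_def second_order_quotient_scaleR[OF k])
      then show ?case
        using VI[OF elim(1), of "k *\<^sub>R Y (k * t)"] D_eq[OF elim(1)]
        by (simp add: blinfun.diff_left blinfun.scaleR_left)
    qed
  qed
  have D_lim: "((\<lambda>t. D t (Y t)) \<longlongrightarrow> ereal (- pairing G y)) (at_right 0)"
  proof (rule Lim_transform_eventually)
    show "((\<lambda>t. ereal (d t)) \<longlongrightarrow> ereal (- pairing G y)) (at_right 0)"
      using d_lim by simp
    show "eventually (\<lambda>t. ereal (d t) = D t (Y t)) (at_right 0)"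
      using ev by eventually_elim (simp add: D_eq)
  qed
  have Q_ge: "ereal (- pairing G y - 2 * pairing G (z - y)) \<le> Q z" for z
    unfolding Q_def second_subderivative_def
  proof (rule Inf_greatest, clarify)
    fix t :: "nat \<Rightarrow> real" and zs
    assume t: "\<forall>n. 0 < t n" "t \<longlonglongrightarrow> 0" and zs: "limitin weak_star_topology zs z sequentially"
    have lim: "filterlim t (at_right 0) sequentially"
      using t by (intro tendsto_imp_filterlim_at_right) auto
    obtain B where B: "\<forall>n. norm (zs n) \<le> B"
      using weak_star_convergent_imp_bounded[OF zs] by (auto simp: bounded_iff)
    have hn: "(\<lambda>n. h (t n)) \<longlonglongrightarrow> G"
      by (rule filterlim_compose[OF h lim])
    have "(\<lambda>n. pairing (h (t n)) (zs n)) \<longlonglongrightarrow> pairing G z"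
      by (rule tendsto_pairing_weak_star[OF hn zs always_eventually[OF B]])
    moreover have "(\<lambda>n. pairing (h (t n)) (Y (1 * t n))) \<longlonglongrightarrow> pairing G y"
      by (rule filterlim_compose[OF hY lim]) simp
    moreover have "(\<lambda>n. d (t n)) \<longlonglongrightarrow> - pairing G y"
      by (rule filterlim_compose[OF d_lim lim])
    ultimately have "(\<lambda>n. d (t n) - 2 * (pairing (h (t n)) (zs n) - pairing (h (t n)) (Y (1 * t n))))
        \<longlonglongrightarrow> - pairing G y - 2 * (pairing G z - pairing G y)"
      by (intro tendsto_diff tendsto_mult_left)
    then have "(\<lambda>n. ereal (d (t n) - 2 * pairing (h (t n)) (zs n - Y (t n))))
        \<longlonglongrightarrow> ereal (- pairing G y - 2 * pairing G (z - y))"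
      by (simp add: blinfun.diff_left)
    then have "ereal (- pairing G y - 2 * pairing G (z - y))
        = liminf (\<lambda>n. ereal (d (t n) - 2 * pairing (h (t n)) (zs n - Y (t n))))"
      by (intro lim_imp_Liminf[symmetric]) auto
    \<comment> \<open>This is \<open>VI\<close> at \<open>t n\<close> tested with
      \<open>zs n\<close> and solved for the quotient.\<close>
    also have "\<dots> \<le> liminf (\<lambda>n. D (t n) (zs n))"
    proof (rule Liminf_mono)
      have "eventually (\<lambda>n. t n \<in> {0<..<t0}) sequentially"
        by (rule eventually_compose_filterlim[OF ev lim])
      then show "eventually (\<lambda>n. ereal (d (t n) - 2 * pairing (h (t n)) (zs n - Y (t n)))
          \<le> D (t n) (zs n)) sequentially"
      proof eventually_elim
        case (elim n)
        then show ?case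
          using VI[OF elim, of "zs n"] D_eq[OF elim] by (cases "D (t n) (zs n)") auto
      qed
    qed
    finally show "ereal (- pairing G y - 2 * pairing G (z - y))
        \<le> liminf (\<lambda>n. second_order_quotient j (xb 0) a0 (t n) (zs n))"
      by (simp add: D_def)
  qed
  have "Q y \<le> ereal (- pairing G y)"
  proof -
    \<comment> \<open>Any positive null sequence would do: the difference quotients themselves form
      a recovery sequence, attaining the lower bound \<open>Q_ge\<close> at
      \<open>y\<close>.\<close>
    define t where "t n = inverse (real (Suc n))" for n
    have t: "\<forall>n. 0 < t n" "t \<longlonglongrightarrow> 0"
      unfolding t_def using LIMSEQ_inverse_real_of_nat by auto
    then have lim: "filterlim t (at_right 0) sequentially"
      by (intro tendsto_imp_filterlim_at_right) auto
    have "limitin weak_star_topology (\<lambda>n. Y (t n)) y sequentially"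
      using Y unfolding limitin_weak_star_iff by (intro allI filterlim_compose[OF _ lim]) blast
    then have "Q y \<le> liminf (\<lambda>n. D (t n) (Y (t n)))"
      unfolding Q_def D_def second_subderivative_def using t
      by (intro Inf_lower CollectI exI[of _ t] exI[of _ "\<lambda>n. Y (t n)"] conjI) auto
    also have "\<dots> = ereal (- pairing G y)"
      by (intro lim_imp_Liminf filterlim_compose[OF D_lim lim]) simp
    finally show ?thesis .
  qed
  then have Q_y: "Q y = ereal (- pairing G y)"
    using Q_ge[of y] by (intro antisym) auto
  \<comment> \<open>Halving \<open>Q_ge\<close> and inserting \<open>Q_y\<close> gives the claim;
    \<open>Q_ge\<close> also excludes \<open>Q z\<close> = -\<infinity>.\<close>
  have "0 \<le> ereal (pairing G (z - y)) + ereal (1 / 2) * Q z - ereal (1 / 2) * Q y" for z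
    using Q_ge[of z] by (cases "Q z") (auto simp: Q_y)
  with Q_y D_lim show ?thesis
    by (simp add: Q_def D_def G_def Y_def)
qed

end
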